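(* Let $q>1$ be the size of the (finite) alphabet and let $j\in\mathbb{N}$. Then there are constants $\alpha_j$ and $n_j$ (depending on $q$ and $j$) such that \[B(n)\leq \alpha_j\,\rho^{[j]}(n)\,q^{n}\quad\text{for all integers } n\geq n_j,\] where $B(n)$ is the number of privileged words of length $n$ over the alphabet.
   Context: $\mathbb{N}$ denotes the set of positive integers. Words are over a fixed finite alphabet $A$ with $q>1$ letters. A non-empty word $w$ is a border of a non-empty word $u$ if $|w|<|u|$ and $w$ is both a prefix and a suffix of $u$. A word $u$ is privileged (recursive definition) if $|u|\leq 1$, or if $u$ has a border $w$ such that $w$ is privileged and $w$ occurs exactly twice as a factor of $u$. $B(n)$ is the number of privileged words of length $n$ over $A$. Iterated logarithm: $\ln^{[0]}(n)=n$ and $\ln^{[j]}(n)=\ln(\ln^{[j-1]}(n))$ for $j\in\mathbb{N}$ (natural logarithm; defined for sufficiently large $n$). Functions $\sigma^{[j]},\rho^{[j]}$ (defined for sufficiently large $n$): $\sigma^{[1]}(n)=\sqrt{\ln n}$; $\sigma^{[2]}(n)=\ln^{[2]}(n)$; $\sigma^{[j]}(n)=\ln^{[j]}(n)\prod_{i=2}^{j-1}\sqrt{\ln^{[i]}(n)}$ for $j\geq 3$; and $\rho^{[j]}(n)=\sigma^{[j]}(n)\frac{\sqrt{\ln n}}{\sqrt{n}}$ for $j\in\mathbb{N}$. *)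

theory Defs
  imports Complex_Main "HOL-Library.Sublist"
begin

definition border :: "'a list \<Rightarrow> 'a list \<Rightarrow> bool" where
  "border w u \<longleftrightarrow> w \<noteq> [] \<and> u \<noteq> [] \<and> length w < length u \<and> prefix w u \<and> suffix w u"

(* An occurrence of w in u is a factorization u = x w y; overlapping occurrences are
   counted separately. *)
definition occurrences :: "'a list \<Rightarrow> 'a list \<Rightarrow> ('a list \<times> 'a list) set" where
  "occurrences w u = {(x, y). u = x @ w @ y}"

inductive privileged :: "'a list \<Rightarrow> bool" where
  short: "length u \<le> 1 \<Longrightarrow> privileged u"
| border: "border w u \<Longrightarrow> privileged w \<Longrightarrow> card (occurrences w u) = 2 \<Longrightarrow> privileged u"

definition num_privileged :: "'a set \<Rightarrow> nat \<Rightarrow> nat" where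
  "num_privileged A n = card {u \<in> lists A. length u = n \<and> privileged u}"

(* HOL's ln is total, so the functions below also take values outside the range in which they
   are mathematically meaningful; only their values at large arguments matter. *)
primrec iter_ln :: "nat \<Rightarrow> real \<Rightarrow> real" where
  "iter_ln 0 x = x"
| "iter_ln (Suc j) x = ln (iter_ln j x)"

(* Meaningful for j \<ge> 1 only; the value at j = 0 is irrelevant. *)
definition sigma :: "nat \<Rightarrow> real \<Rightarrow> real" where
  "sigma j x =
    (if j = 1 then sqrt (ln x)
     else if j = 2 then iter_ln 2 x
     else iter_ln j x * (\<Prod>i = 2..j - 1. sqrt (iter_ln i x)))"

definition rho :: "nat \<Rightarrow> real \<Rightarrow> real" where
  "rho j x = sigma j x * (sqrt (ln x) / sqrt x)"

end

theory Submission
  imports Defs "HOL-Real_Asymp.Real_Asymp"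
begin

text \<open>
  A privileged word of length n \<open>\<ge>\<close> 2 has a border w occurring exactly twice; only this property
  is used. A word with a border of length m has period n - m, so there are at most q^(n - m) of
  them; summing over the m with q^m \<open>\<ge>\<close> sqrt n gives O(q^n / sqrt n). If q^m < sqrt n, the part
  strictly between the two occurrences avoids w, and cutting it into blocks of length m
  shows that there are only about q^n exp(- n / (m q^m)) such words, which is negligible. Hence
  B(n) = O(q^n / sqrt n), and rho j n \<open>\<ge>\<close> 1 / sqrt n for all large n.
\<close>

section \<open>Words with a given border length, and words avoiding a factor\<close>

text \<open>Closed words in the sense of combinatorics on words (complete returns to the border),
  graded by the border length.\<close>

definition closed_words :: "'a set \<Rightarrow> nat \<Rightarrow> nat \<Rightarrow> 'a list set" where
  "closed_words A n m = {u \<in> lists A. length u = n \<and>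
     (\<exists>w. length w = m \<and> border w u \<and> card (occurrences w u) = 2)}"

definition avoiding_words :: "'a set \<Rightarrow> 'a list \<Rightarrow> nat \<Rightarrow> 'a list set" where
  "avoiding_words A w n = {v \<in> lists A. length v = n \<and> \<not> sublist w v}"

lemma card_words: "finite A \<Longrightarrow> card {u \<in> lists A. length u = n} = card A ^ n"
  using card_lists_length_eq[of A n] by (simp add: lists_eq_set conj_commute)

lemma finite_words: "finite A \<Longrightarrow> finite {u \<in> lists A. length u = n}"
  using finite_lists_length_eq[of A n] by (simp add: lists_eq_set conj_commute)

lemma finite_closed_words: "finite A \<Longrightarrow> finite (closed_words A n m)"
  by (rule finite_subset[OF _ finite_words[of A n]]) (auto simp: closed_words_def)

lemma finite_avoiding_words: "finite A \<Longrightarrow> finite (avoiding_words A w n)"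
  by (rule finite_subset[OF _ finite_words[of A n]]) (auto simp: avoiding_words_def)

section \<open>Long borders: counting by period\<close>

text \<open>Both sides are letter \<open>i\<close> of \<open>w\<close>, read in its suffix and in
  its prefix occurrence.\<close>

lemma border_nth_period:
  assumes "border w u" "i < length w"
  shows "u ! (i + (length u - length w)) = u ! i"
proof -
  obtain s t where "u = w @ s" "u = t @ w"
    using assms(1) unfolding border_def prefix_def suffix_def by blast
  moreover from this have "length t = length u - length w"
    by (metis add_diff_cancel_right' length_append)
  ultimately show ?thesis
    using assms(2) by (metis add.commute nth_append nth_append_length_plus)
qed

text \<open>The period \<open>n - m\<close> makes a word recoverable from its prefix of that length;
  the two border occurrences may overlap here.\<close>

lemma card_closed_words_le_period:
  assumes "finite A" "m < n"
  shows "card (closed_words A n m) \<le> card A ^ (n - m)"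
proof -
  define p where "p = n - m"
  have p: "p > 0" "p \<le> n" using assms(2) by (auto simp: p_def)
  have per: "u ! i = u ! (i - p)" if "u \<in> closed_words A n m" "p \<le> i" "i < n" for u i
    using that border_nth_period[of _ u "i - p"] assms(2)
    by (fastforce simp: closed_words_def p_def)
  have "inj_on (take p) (closed_words A n m)"
  proof (rule inj_onI)
    fix u v assume u: "u \<in> closed_words A n m" and v: "v \<in> closed_words A n m"
      and eq: "take p u = take p v"
    \<comment> \<open>A letter beyond the prefix copies the one \<open>p\<close> places earlier, and
      \<open>p > 0\<close> makes the index decrease.\<close>
    have "u ! i = v ! i" if "i < n" for i
      using that
    proof (induction i rule: less_induct)
      case (less i)
      show ?case
      proof (cases "i < p")
        case True
        then show ?thesis using eq by (metis nth_take)
      next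
        case False
        then show ?thesis using per[OF u, of i] per[OF v, of i] less p by simp
      qed
    qed
    then show "u = v"
      using u v by (intro nth_equalityI) (auto simp: closed_words_def)
  qed
  moreover have "take p ` closed_words A n m \<subseteq> {u \<in> lists A. length u = p}"
    using p by (auto simp: closed_words_def dest: in_set_takeD)
  ultimately have "card (closed_words A n m) \<le> card {u \<in> lists A. length u = p}"
    using card_inj_on_le finite_words[OF assms(1)] by blast
  then show ?thesis using card_words[OF assms(1)] by (simp add: p_def)
qed

section \<open>Counting words that avoid a factor\<close>

text \<open>Cut off the first block of length \<open>length w\<close>: it is a word other than
  \<open>w\<close>, and the remainder still avoids \<open>w\<close>.\<close>

lemma card_avoiding_words_step:
  assumes "finite A" "w \<in> lists A"
  shows "card (avoiding_words A w (length w + n))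
           \<le> (card A ^ length w - 1) * card (avoiding_words A w n)"
proof -
  let ?m = "length w"
  let ?f = "\<lambda>v :: 'a list. (take ?m v, drop ?m v)"
  let ?B = "{u \<in> lists A. length u = ?m} - {w}"
  have inj: "inj_on ?f (avoiding_words A w (?m + n))"
    by (rule inj_onI) (metis append_take_drop_id prod.inject)
  have "take ?m v \<noteq> w" "\<not> sublist w (drop ?m v)" if "\<not> sublist w v" for v
    using that by (metis sublist_take, metis sublist_drop sublist_order.order_trans)
  then have "?f ` avoiding_words A w (?m + n) \<subseteq> ?B \<times> avoiding_words A w n"
    by (auto simp: avoiding_words_def dest: in_set_takeD in_set_dropD)
  then have "card (avoiding_words A w (?m + n)) \<le> card (?B \<times> avoiding_words A w n)"
    using card_inj_on_le[OF inj] finite_words[OF assms(1), of ?m] finite_avoiding_words[OF assms(1)]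
    by blast
  also have "\<dots> = (card A ^ ?m - 1) * card (avoiding_words A w n)"
    using assms card_words[OF assms(1), of ?m]
    by (simp add: card_cartesian_product card_Diff_singleton)
  finally show ?thesis .
qed

lemma card_avoiding_words_le:
  assumes "finite A" "w \<in> lists A"
  shows "card (avoiding_words A w (k * length w + r))
           \<le> (card A ^ length w - 1) ^ k * card A ^ r"
proof (induction k)
  case 0
  have "card (avoiding_words A w r) \<le> card {u \<in> lists A. length u = r}"
    by (rule card_mono[OF finite_words[OF assms(1)]]) (auto simp: avoiding_words_def)
  then show ?case using card_words[OF assms(1)] by simp
next
  case (Suc k)
  have "card (avoiding_words A w (Suc k * length w + r))
          \<le> (card A ^ length w - 1) * card (avoiding_words A w (k * length w + r))"
    using card_avoiding_words_step[OF assms, of "k * length w + r"] by (simp add: add.assoc)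
  also have "\<dots> \<le> (card A ^ length w - 1) * ((card A ^ length w - 1) ^ k * card A ^ r)"
    using Suc by (rule mult_le_mono2)
  finally show ?case by (simp add: mult.assoc)
qed

section \<open>Short borders: counting by blocks\<close>

text \<open>An occurrence of \<open>w\<close> inside \<open>v\<close> would be a third one, beside
  the prefix and the suffix.\<close>

lemma two_occurrences_middle_avoids:
  assumes "w \<noteq> []" "card (occurrences w (w @ v @ w)) = 2"
  shows "\<not> sublist w v"
proof
  assume "sublist w v"
  then obtain x y where v: "v = x @ w @ y" by (auto simp: sublist_def)
  \<comment> \<open>The contexts of the three occurrences; since \<open>w\<close> is nonempty, their
    left parts have different lengths.\<close>
  let ?S = "{([], v @ w), (w @ x, y @ w), (w @ v, [])}"
  have "?S \<subseteq> occurrences w (w @ v @ w)" by (auto simp: occurrences_def v)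
  \<comment> \<open>An infinite set has \<open>card\<close> 0, so the value 2 forces
    finiteness.\<close>
  moreover have "finite (occurrences w (w @ v @ w))"
    using assms(2) by (metis card.infinite zero_neq_numeral)
  moreover have "card ?S = 3" using assms(1) by (auto simp: v)
  ultimately show False using card_mono[of "occurrences w (w @ v @ w)" ?S] assms(2) by simp
qed

text \<open>As \<open>2 * m \<le> n\<close>, the two occurrences do not overlap and the word is
  \<open>w @ v @ w\<close>. There are \<open>card A ^ m\<close> choices of \<open>w\<close>, and for
  each of them \<open>v\<close> avoids \<open>w\<close>.\<close>

lemma card_closed_words_le_blocks:
  assumes "finite A" "m > 0" "n = 2 * m + (k * m + r)"
  shows "card (closed_words A n m) \<le> card A ^ m * ((card A ^ m - 1) ^ k * card A ^ r)"
proof -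
  let ?L = "k * m + r"
  let ?f = "\<lambda>u :: 'a list. (take m u, take ?L (drop m u))"
  let ?W = "{w \<in> lists A. length w = m}"
  have decomp: "\<exists>w v. u = w @ v @ w \<and> w \<in> ?W \<and> v \<in> avoiding_words A w ?L"
    if u: "u \<in> closed_words A n m" for u
  proof -
    obtain w where w: "length w = m" "border w u" "card (occurrences w u) = 2"
      and len: "length u = n" and A: "u \<in> lists A"
      using u by (auto simp: closed_words_def)
    obtain s where s: "u = w @ s"
      using w(2) by (auto simp: border_def prefix_def)
    have "suffix w u" using w(2) by (simp add: border_def)
    moreover have "suffix s u" "length w \<le> length s"
      using s len w(1) assms(3) by (auto intro: suffixI)
    ultimately have "suffix w s" by (rule suffix_length_suffix)
    then obtain v where v: "s = v @ w" by (auto simp: suffix_def)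
    have "\<not> sublist w v"
      using two_occurrences_middle_avoids[of w v] w s v assms(2) by auto
    then show ?thesis
      using s v w(1) len A assms(3) by (auto simp: avoiding_words_def)
  qed
  have f: "?f (w @ v @ w) = (w, v)" if "w \<in> ?W" "v \<in> avoiding_words A w ?L" for w v
    using that by (auto simp: avoiding_words_def)
  have "inj_on ?f (closed_words A n m)"
    by (rule inj_onI) (metis (no_types, lifting) decomp f prod.inject)
  moreover have "?f ` closed_words A n m \<subseteq> Sigma ?W (\<lambda>w. avoiding_words A w ?L)"
    using decomp f by fastforce
  moreover have fin: "finite ?W" "\<forall>w\<in>?W. finite (avoiding_words A w ?L)"
    using finite_words finite_avoiding_words assms(1) by auto
  ultimately have "card (closed_words A n m) \<le> card (Sigma ?W (\<lambda>w. avoiding_words A w ?L))"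
    by (intro card_inj_on_le[of ?f] finite_SigmaI) auto
  also have "\<dots> = (\<Sum>w\<in>?W. card (avoiding_words A w ?L))"
    using fin by (rule card_SigmaI)
  also have "\<dots> \<le> (\<Sum>w\<in>?W. (card A ^ m - 1) ^ k * card A ^ r)"
  proof (rule sum_mono)
    fix w assume "w \<in> ?W"
    then show "card (avoiding_words A w ?L) \<le> (card A ^ m - 1) ^ k * card A ^ r"
      using card_avoiding_words_le[OF assms(1), of w k r] by auto
  qed
  also have "\<dots> = card A ^ m * ((card A ^ m - 1) ^ k * card A ^ r)"
    using card_words[OF assms(1)] by simp
  finally show ?thesis .
qed

text \<open>Excluding one of the \<open>q ^ m\<close> possible blocks costs a factor
  \<open>1 - 1 / q ^ m\<close>, at most \<open>exp (- (1 / q ^ m))\<close>, per full block of the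
  middle part.\<close>

lemma card_closed_words_le_exp:
  assumes "finite A" "card A > 1" "m > 0" "2 * m \<le> n"
  shows "real (card (closed_words A n m))
           \<le> real (card A) ^ n * exp (- (real n / real m - 3) / real (card A) ^ m)"
proof -
  define q where "q = real (card A)"
  define k r where "k = (n - 2 * m) div m" and "r = (n - 2 * m) mod m"
  have q: "q > 1" using assms(2) by (simp add: q_def)
  have n: "n = 2 * m + (k * m + r)" using assms(4) by (simp add: k_def r_def)
  have "r < m" using assms(3) by (simp add: r_def)
  \<comment> \<open>The 3 accounts for the two borders and the incomplete last block.\<close>
  then have "n \<le> 3 * m + k * m" using n by linarith
  then have "real n \<le> 3 * real m + real k * real m"
    by (metis of_nat_add of_nat_le_iff of_nat_mult of_nat_numeral)
  then have k: "real n / real m - 3 \<le> real k"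
    using assms(3) by (simp add: field_simps)
  have "real (card (closed_words A n m))
          \<le> real (card A ^ m * ((card A ^ m - 1) ^ k * card A ^ r))"
    using card_closed_words_le_blocks[OF assms(1,3) n] by (rule of_nat_mono)
  also have "\<dots> = q ^ m * ((q ^ m - 1) ^ k * q ^ r)"
    using assms(2) by (simp add: q_def of_nat_diff)
  also have "(q ^ m - 1) ^ k = (q ^ m) ^ k * (1 - 1 / q ^ m) ^ k"
  proof -
    have "q ^ m - 1 = q ^ m * (1 - 1 / q ^ m)" using q by (simp add: field_simps)
    then show ?thesis by (metis power_mult_distrib)
  qed
  also have "q ^ m * ((q ^ m) ^ k * (1 - 1 / q ^ m) ^ k * q ^ r)
               = q ^ (n - m) * (1 - 1 / q ^ m) ^ k"
  proof -
    have e: "n - m = m + (m * k + r)" using n by (simp add: mult.commute)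
    show ?thesis unfolding e power_add power_mult by (simp only: mult_ac)
  qed
  \<comment> \<open>The factor \<open>q ^ m\<close> given away here is harmless, as the bound is
    applied only with \<open>q ^ m\<close> at most \<open>sqrt n\<close>.\<close>
  also have "\<dots> \<le> q ^ n * exp (- (1 / q ^ m)) ^ k"
  proof (intro mult_mono power_mono)
    show "q ^ (n - m) \<le> q ^ n" using q by (intro power_increasing) auto
    show "1 - 1 / q ^ m \<le> exp (- (1 / q ^ m))"
      using exp_ge_add_one_self[of "- (1 / q ^ m)"] by simp
    show "0 \<le> 1 - 1 / q ^ m" using q by (simp add: one_le_power)
  qed (use q in \<open>simp_all add: one_le_power\<close>)
  also have "exp (- (1 / q ^ m)) ^ k = exp (- real k / q ^ m)"
    by (simp flip: exp_of_nat_mult)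
  also have "q ^ n * \<dots> \<le> q ^ n * exp (- (real n / real m - 3) / q ^ m)"
    using k q by (intro mult_left_mono) (auto simp: divide_right_mono simp del: minus_diff_eq)
  finally show ?thesis by (simp add: q_def)
qed

section \<open>Summation over the border length\<close>

text \<open>A union bound: for \<open>n \<ge> 2\<close> only the \<open>border\<close> rule can make
  a word privileged.\<close>

lemma num_privileged_le_sum:
  assumes "finite A" "n \<ge> 2"
  shows "num_privileged A n \<le> (\<Sum>m = 1..<n. card (closed_words A n m))"
proof -
  have "{u \<in> lists A. length u = n \<and> privileged u} \<subseteq> (\<Union>m\<in>{1..<n}. closed_words A n m)"
  proof
    fix u assume u: "u \<in> {u \<in> lists A. length u = n \<and> privileged u}"
    then obtain w where w: "border w u" "card (occurrences w u) = 2"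
      using assms(2) by (auto elim: privileged.cases)
    then have "length w \<in> {1..<n}"
      using u by (auto simp: border_def Suc_le_eq)
    then show "u \<in> (\<Union>m\<in>{1..<n}. closed_words A n m)"
      using u w by (auto simp: closed_words_def)
  qed
  then have "num_privileged A n \<le> card (\<Union>m\<in>{1..<n}. closed_words A n m)"
    unfolding num_privileged_def using finite_closed_words[OF assms(1)] by (intro card_mono) auto
  also have "\<dots> \<le> (\<Sum>m = 1..<n. card (closed_words A n m))"
    by (rule card_UN_le) simp
  finally show ?thesis .
qed

text \<open>Telescoping: for \<open>q \<ge> 2\<close> each term \<open>1 / q ^ c\<close> is at most
  \<open>2 / q ^ c - 2 / q ^ Suc c\<close>.\<close>

lemma sum_inverse_powers_le:
  fixes q :: real
  assumes "q \<ge> 2"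
  shows "(\<Sum>m = a..<b. 1 / q ^ m) \<le> 2 / q ^ a"
proof (cases "a \<le> b")
  case True
  have "(\<Sum>m = a..<b. 1 / q ^ m) \<le> 2 / q ^ a - 2 / q ^ b"
    using True
  proof (induction b rule: dec_induct)
    case base
    then show ?case by simp
  next
    case (step c)
    have "2 / q ^ Suc c \<le> 1 / q ^ c" using assms by (simp add: field_simps)
    then show ?case using step by simp
  qed
  moreover have "0 \<le> 2 / q ^ b" using assms by simp
  ultimately show ?thesis by linarith
qed (use assms in simp)

text \<open>Relative to \<open>q ^ n\<close>, the short borders contribute at most
  \<open>1 / sqrt n\<close> in total and the long ones at most \<open>2 / sqrt n\<close>.
  Quantifying \<open>A\<close> inside the filter gives one threshold for all alphabets of size
  \<open>q\<close>.\<close>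

lemma num_privileged_le_inverse_sqrt:
  assumes "q > 1"
  shows "\<forall>\<^sub>F n in sequentially. \<forall>A :: 'a set. finite A \<and> card A = q \<longrightarrow>
           real (num_privileged A n) \<le> 3 * (1 / sqrt (real n)) * real q ^ n"
proof -
  \<comment> \<open>There are at most \<open>ln n + 1\<close> short lengths \<open>m\<close>; in the
    exponential, \<open>m\<close> and \<open>q ^ m\<close> are replaced by their upper bounds
    \<open>ln n\<close> and \<open>sqrt n\<close>.\<close>
  have ev: "\<forall>\<^sub>F n :: nat in sequentially. (ln (real n) + 1) *
              exp (- (real n / ln (real n) - 3) / sqrt (real n)) \<le> 1 / sqrt (real n)"
    by real_asymp
  \<comment> \<open>This yields \<open>2 * m \<le> n\<close> for short borders, and
    \<open>a \<le> n\<close>.\<close>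
  have ev2: "\<forall>\<^sub>F n :: nat in sequentially. 2 * (ln (real n) + 1) \<le> real n"
    by real_asymp
  \<comment> \<open>This keeps \<open>n / ln n - 3\<close> nonnegative, so that enlarging the
    denominator \<open>Q ^ m\<close> to \<open>sqrt n\<close> decreases the quotient.\<close>
  have ev3: "\<forall>\<^sub>F n :: nat in sequentially. 3 * ln (real n) \<le> real n"
    by real_asymp
  show ?thesis
    using ev ev2 ev3 eventually_ge_at_top[of 2]
  proof eventually_elim
    case (elim n)
    define Q where "Q = real q"
    have Q: "Q \<ge> 2" using assms by (simp add: Q_def)
    \<comment> \<open>The least exponent with \<open>Q ^ a \<ge> sqrt n\<close>: the cut between
      short and long borders.\<close>
    define a where "a = nat \<lceil>log Q (sqrt (real n))\<rceil>"
    define E :: real where "E = exp (- (real n / ln (real n) - 3) / sqrt (real n))"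
    have E_pos: "E > 0" by (simp add: E_def)
    have n: "real n \<ge> 2" "sqrt (real n) \<ge> 1" using elim by auto
    have lg0: "log Q (sqrt (real n)) \<ge> 0" using n Q by simp
    \<comment> \<open>With this, \<open>log Q (sqrt n) = ln n / (2 * ln Q)\<close> is at most
      \<open>ln n\<close>, whatever \<open>q\<close> is.\<close>
    have lnQ: "ln Q \<ge> 1 / 2"
    proof -
      have "1 / 2 \<le> ln (2 :: real)" using ln_le_minus_one[of "1 / 2 :: real"] by (simp add: ln_div)
      also have "\<dots> \<le> ln Q" using Q by simp
      finally show ?thesis .
    qed
    have lg: "log Q (sqrt (real n)) \<le> ln (real n)"
    proof -
      have "log Q (sqrt (real n)) = ln (real n) / (2 * ln Q)"
        using n by (simp add: log_def ln_sqrt)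
      also have "\<dots> \<le> ln (real n)"
        using lnQ mult_left_mono[of 1 "2 * ln Q" "ln (real n)"] n by (simp add: divide_le_eq)
      finally show ?thesis .
    qed
    have a: "sqrt (real n) \<le> Q ^ a"
    proof -
      have "sqrt (real n) = Q powr log Q (sqrt (real n))" using Q n by simp
      also have "\<dots> \<le> Q powr real a"
        using Q real_nat_ceiling_ge[of "log Q (sqrt (real n))"] by (intro powr_mono) (auto simp: a_def)
      also have "\<dots> = Q ^ a" using Q by (simp add: powr_realpow)
      finally show ?thesis .
    qed
    have a_le: "real a \<le> ln (real n) + 1" using lg lg0 by (simp add: a_def) linarith
    have small: "Q ^ m \<le> sqrt (real n)" "real m \<le> ln (real n)" if "m < a" for m
    proof -
      have m: "real m \<le> log Q (sqrt (real n))"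
        using that unfolding a_def by linarith
      have "Q ^ m = Q powr real m" using Q by (simp add: powr_realpow)
      also have "\<dots> \<le> Q powr log Q (sqrt (real n))" using m Q by (intro powr_mono) auto
      also have "\<dots> = sqrt (real n)" using Q n by simp
      finally show "Q ^ m \<le> sqrt (real n)" .
      show "real m \<le> ln (real n)" using m lg by simp
    qed
    show ?case
    proof (intro allI impI)
      fix A :: "'a set" assume A: "finite A \<and> card A = q"
      have an: "a \<le> n" using a_le elim n by linarith
      have "real (num_privileged A n) \<le> (\<Sum>m = 1..<n. real (card (closed_words A n m)))"
        using num_privileged_le_sum[of A n] A elim by (metis of_nat_mono of_nat_sum)
      also have "\<dots> \<le> (\<Sum>m = 1..<n. if m < a
           then Q ^ n * E else Q ^ n * (1 / Q ^ m))"
      proof (rule sum_mono)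
        fix m assume m: "m \<in> {1..<n}"
        show "real (card (closed_words A n m)) \<le> (if m < a
           then Q ^ n * E else Q ^ n * (1 / Q ^ m))"
        proof (cases "m < a")
          case True
          note sm = small[OF True]
          have "2 * real m \<le> real n" using sm elim by linarith
          then have "2 * m \<le> n" by linarith
          then have "real (card (closed_words A n m))
                       \<le> Q ^ n * exp (- (real n / real m - 3) / Q ^ m)"
            using card_closed_words_le_exp[of A m n] A assms m by (simp add: Q_def)
          also have "\<dots> \<le> Q ^ n * E"
          proof -
            have "0 \<le> real n / ln (real n) - 3" using elim n by (simp add: field_simps)
            moreover have "real n / ln (real n) \<le> real n / real m"
              using sm m by (intro divide_left_mono) auto
            ultimately have "(real n / ln (real n) - 3) / sqrt (real n) \<le> (real n / real m - 3) / Q ^ m"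
              using sm Q by (intro frac_le) auto
            then show ?thesis using Q unfolding E_def by (intro mult_left_mono) (auto simp del: minus_diff_eq)
          qed
          finally show ?thesis using True by simp
        next
          case False
          have "real (card (closed_words A n m)) \<le> Q ^ (n - m)"
            using of_nat_mono[OF card_closed_words_le_period[of A m n], where 'a = real] A m
            by (simp add: Q_def)
          also have "\<dots> = Q ^ n * (1 / Q ^ m)" using Q m by (simp add: power_diff)
          finally show ?thesis using False by simp
        qed
      qed
      \<comment> \<open>Adding the nonnegative term at 0 makes the short part a sum of exactly
        \<open>a\<close> equal terms.\<close>
      also have "\<dots> \<le> (\<Sum>m = 0..<n. if m < a
           then Q ^ n * E else Q ^ n * (1 / Q ^ m))"
        using Q by (intro sum_mono2) (auto simp: E_def)
      also have "\<dots> = (\<Sum>m = 0..<a. Q ^ n * E)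
            + (\<Sum>m = a..<n. Q ^ n * (1 / Q ^ m))"
        using an by (subst sum.atLeastLessThan_concat[of 0 a n, symmetric]) auto
      also have "\<dots> = Q ^ n * (real a * E
            + (\<Sum>m = a..<n. 1 / Q ^ m))"
        by (simp add: sum_distrib_left algebra_simps)
      also have "\<dots> \<le> Q ^ n * (1 / sqrt (real n) + 2 / sqrt (real n))"
      proof (intro mult_left_mono add_mono)
        show "real a * E \<le> 1 / sqrt (real n)"
          using elim(1)[folded E_def] mult_right_mono[OF a_le, of E] E_pos by linarith
        have "(\<Sum>m = a..<n. 1 / Q ^ m) \<le> 2 / Q ^ a" by (rule sum_inverse_powers_le[OF Q])
        also have "\<dots> \<le> 2 / sqrt (real n)" using a n Q by (intro divide_left_mono) auto
        finally show "(\<Sum>m = a..<n. 1 / Q ^ m) \<le> 2 / sqrt (real n)" .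
      qed (use Q in simp)
      finally show "real (num_privileged A n) \<le> 3 * (1 / sqrt (real n)) * real q ^ n"
        by (simp add: Q_def algebra_simps)
    qed
  qed
qed

section \<open>Comparison with \<open>rho\<close>\<close>

lemma filterlim_iter_ln: "filterlim (iter_ln j) at_top at_top"
proof (induction j)
  case 0
  have "iter_ln 0 = (\<lambda>x. x)" by auto
  then show ?case by (simp add: filterlim_ident)
next
  case (Suc j)
  have "iter_ln (Suc j) = (\<lambda>x. ln (iter_ln j x))" by auto
  then show ?case using filterlim_compose[OF ln_at_top Suc] by simp
qed

lemma eventually_iter_ln_ge_1: "\<forall>\<^sub>F x in at_top. iter_ln j x \<ge> 1"
  using filterlim_iter_ln by (auto simp: filterlim_at_top)

text \<open>Every factor is an iterated logarithm or the square root of one, hence eventually at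
  least 1.\<close>

lemma eventually_sigma_ge_1: "\<forall>\<^sub>F x in at_top. sigma j x \<ge> 1"
proof -
  \<comment> \<open>The bound \<open>j + 2\<close> brings in the indices 1 and 2 of the special
    cases for every \<open>j\<close>.\<close>
  have "\<forall>\<^sub>F x in at_top. \<forall>i\<in>{..j + 2}. iter_ln i x \<ge> 1"
    using eventually_iter_ln_ge_1 by (simp add: eventually_ball_finite_distrib)
  then show ?thesis
  proof eventually_elim
    case (elim x)
    have "(\<Prod>i = 2..j - 1. sqrt (iter_ln i x)) \<ge> 1"
      using elim by (intro prod_ge_1) auto
    moreover have "iter_ln j x \<ge> 1" "iter_ln 2 x \<ge> 1" "ln x \<ge> 1"
      using elim bspec[OF elim, of 1] by auto
    ultimately show ?case
      using mult_mono[of 1 "iter_ln j x" 1 "\<Prod>i = 2..j - 1. sqrt (iter_ln i x)"]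
      by (auto simp: sigma_def)
  qed
qed

text \<open>The extra factor \<open>sigma j x * sqrt (ln x)\<close> is eventually at least
  1.\<close>

lemma eventually_rho_ge: "\<forall>\<^sub>F x in at_top. 1 / sqrt x \<le> rho j x"
  using eventually_sigma_ge_1[of j] eventually_iter_ln_ge_1[of 1] eventually_gt_at_top[of 0]
proof eventually_elim
  case (elim x)
  then have "1 * (1 / sqrt x) \<le> sigma j x * (sqrt (ln x) / sqrt x)"
    by (intro mult_mono divide_right_mono) auto
  then show ?case by (simp add: rho_def)
qed

theorem theorem1p2:
  fixes q j :: nat
  assumes "q > 1" and "j \<ge> 1"
  shows "\<exists>(\<alpha> :: real) (n\<^sub>0 :: nat). \<forall>A :: 'a set. finite A \<and> card A = q \<longrightarrow>
           (\<forall>n \<ge> n\<^sub>0. real (num_privileged A n) \<le> \<alpha> * rho j (real n) * real q ^ n)"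
proof -
  \<comment> \<open>The constant 3 serves as \<alpha> for every \<open>j\<close>, and the threshold
    of this filter statement becomes \<open>n\<^sub>0\<close>.\<close>
  have "\<forall>\<^sub>F n in sequentially. \<forall>A :: 'a set. finite A \<and> card A = q \<longrightarrow>
          real (num_privileged A n) \<le> 3 * rho j (real n) * real q ^ n"
    using num_privileged_le_inverse_sqrt[OF assms(1), where 'a = 'a]
      eventually_compose_filterlim[OF eventually_rho_ge[of j] filterlim_real_sequentially]
  proof eventually_elim
    case (elim n)
    have "3 * (1 / sqrt (real n)) * real q ^ n \<le> 3 * rho j (real n) * real q ^ n"
      using elim(2) by (intro mult_right_mono) auto
    then show ?case using elim(1) by force
  qed
  then show ?thesis by (auto simp: eventually_sequentially)
qed

end
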